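(* Let $F$ be an ordered field with an integer part $I$, let $\rho\in F$ be rational and $\alpha\in F$ irrational, with $1<\rho<\alpha<2$. Then $N_{\rho}\neq N_{\alpha}$.
   Context: A subring $I$ of an ordered field $F$ is an integer part of $F$ if $I$ is discretely ordered (no $x\in I$ satisfies $0<x<1$) and for every $x\in F$ there is a (necessarily unique) $a\in I$ with $a\leqslant x<a+1$; this $a$ is denoted $\lfloor x\rfloor$. $I^{\geqslant 0}=\{x\in I: x\geqslant 0\}$. An element of $F$ is rational if it lies in the fraction field $\mathrm{Frac}(I)\subseteq F$, and irrational otherwise. For $\alpha\in F$ positive, $N_\alpha=\{\lfloor n\alpha\rfloor : n\in I^{\geqslant 0}\}$. *)

theory Defs
  imports Main
begin

definition is_subring :: "'a::linordered_field set \<Rightarrow> bool" where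
  "is_subring I \<longleftrightarrow>
     0 \<in> I \<and> 1 \<in> I \<and>
     (\<forall>x\<in>I. \<forall>y\<in>I. x + y \<in> I) \<and>
     (\<forall>x\<in>I. - x \<in> I) \<and>
     (\<forall>x\<in>I. \<forall>y\<in>I. x * y \<in> I)"

definition discretely_ordered :: "'a::linordered_field set \<Rightarrow> bool" where
  "discretely_ordered I \<longleftrightarrow> \<not> (\<exists>x\<in>I. 0 < x \<and> x < 1)"

text \<open>The ordered field $F$ is the type, and $I$ is a subset of it. The class
  \<^class>\<open>linordered_field\<close> does not assume the Archimedean property.\<close>

definition integer_part :: "'a::linordered_field set \<Rightarrow> bool" where
  "integer_part I \<longleftrightarrow>
     is_subring I \<and> discretely_ordered I \<and>
     (\<forall>x. \<exists>a\<in>I. a \<le> x \<and> x < a + 1)"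

definition ipart_floor :: "'a::linordered_field set \<Rightarrow> 'a \<Rightarrow> 'a" where
  "ipart_floor I x = (THE a. a \<in> I \<and> a \<le> x \<and> x < a + 1)"

definition nonneg_part :: "'a::linordered_field set \<Rightarrow> 'a set" where
  "nonneg_part I = {x \<in> I. 0 \<le> x}"

definition Frac :: "'a::linordered_field set \<Rightarrow> 'a set" where
  "Frac I = {a / b | a b. a \<in> I \<and> b \<in> I \<and> b \<noteq> 0}"

definition rational_over :: "'a::linordered_field set \<Rightarrow> 'a \<Rightarrow> bool" where
  "rational_over I x \<longleftrightarrow> x \<in> Frac I"

definition irrational_over :: "'a::linordered_field set \<Rightarrow> 'a \<Rightarrow> bool" where
  "irrational_over I x \<longleftrightarrow> \<not> rational_over I x"

definition beatty_set :: "'a::linordered_field set \<Rightarrow> 'a \<Rightarrow> 'a set" where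
  "beatty_set I \<alpha> = {ipart_floor I (n * \<alpha>) | n. n \<in> nonneg_part I}"

text \<open>The element given by \<^const>\<open>ipart_floor\<close> is unique, so the description is well defined.\<close>

lemma ipart_floor_unique:
  assumes "integer_part I"
  shows "\<exists>!a. a \<in> I \<and> a \<le> x \<and> x < a + 1"
proof -
  have le: "a \<le> b"
    if "a \<in> I" "b \<in> I" "a \<le> x" "x < b + 1" for a b
  proof (rule ccontr)
    assume "\<not> a \<le> b"
    moreover have "a - b \<in> I"
      using assms that(1,2) unfolding integer_part_def is_subring_def
      by (metis add_uminus_conv_diff)
    moreover have "a - b < 1"
      using that(3,4) by (simp add: algebra_simps)
    ultimately show False
      using assms unfolding integer_part_def discretely_ordered_def
      by (metis diff_gt_0_iff_gt not_le)
  qed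
  obtain a where "a \<in> I" "a \<le> x" "x < a + 1"
    using assms unfolding integer_part_def by blast
  then show ?thesis
    by (metis le order_antisym)
qed

end

theory Submission
  imports Defs
begin

text \<open>
  Write \<open>\<rho> = a / b\<close> with \<open>a, b\<close> positive in \<open>I\<close>. The set \<open>N\<^sub>\<rho>\<close> has period \<open>a\<close>, and the part of this
  that matters is the position of the gaps: every positive multiple \<open>k * a\<close> lies in \<open>N\<^sub>\<rho>\<close>, while its
  predecessor \<open>k * a - 1\<close> does not (lemma \<open>beatty_rational_gap\<close>).

  No irrational \<open>\<alpha>\<close> with \<open>1 < \<alpha> < 2\<close> has this pattern. If \<open>k * a\<close> lies in \<open>N\<^sub>\<alpha>\<close> and \<open>k * a - 1\<close> does
  not, then some multiple \<open>n * \<alpha>\<close> lands so early in the unit interval starting at \<open>k * a\<close> that the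
  previous multiple falls below \<open>k * a - 1\<close>: its excess \<open>n * \<alpha> - k * a\<close> lies in \<open>[0, \<alpha> - 1)\<close> (lemma
  \<open>beatty_gap_excess\<close>). Thus modulo \<open>\<alpha>\<close> all points \<open>- k * a\<close> stay in the interval \<open>[0, \<alpha> - 1)\<close>, which
  is shorter than half the circle because \<open>\<alpha> < 2\<close>. But for \<open>k = 1\<close> the excess \<open>d\<close> is nonzero by
  irrationality, so its first multiple \<open>j * d\<close> beyond \<open>\<alpha> - 1\<close> leaves this interval without going
  once around the circle. This multiple is found with the integer part, by division,
  so the argument needs neither induction on \<open>I\<close> nor the Archimedean property, and it never compares
  the \<open>n\<close>-th terms of the two sequences.
\<close>

context
  fixes I :: "'a::linordered_field set"
  assumes I: "integer_part I"
begin

lemma int_one: "1 \<in> I"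
  and int_add: "x \<in> I \<Longrightarrow> y \<in> I \<Longrightarrow> x + y \<in> I"
  and int_minus: "x \<in> I \<Longrightarrow> - x \<in> I"
  and int_mult: "x \<in> I \<Longrightarrow> y \<in> I \<Longrightarrow> x * y \<in> I"
  using I unfolding integer_part_def is_subring_def by auto

lemma int_diff: "x \<in> I \<Longrightarrow> y \<in> I \<Longrightarrow> x - y \<in> I"
  using int_add[of x "- y"] int_minus by simp

lemma int_less_imp_add1_le:
  assumes "x \<in> I" "y \<in> I" "x < y"
  shows "x + 1 \<le> y"
proof (rule ccontr)
  assume "\<not> x + 1 \<le> y"
  then have "0 < y - x \<and> y - x < 1"
    using assms by (auto simp: algebra_simps)
  then show False
    using int_diff[OF assms(2,1)] I unfolding integer_part_def discretely_ordered_def by blast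
qed

lemma ipart_floor_eq_iff:
  "ipart_floor I x = m \<longleftrightarrow> m \<in> I \<and> m \<le> x \<and> x < m + 1"
  unfolding ipart_floor_def
  using theI'[OF ipart_floor_unique[OF I, of x]] the1_equality[OF ipart_floor_unique[OF I, of x]]
  by blast

text \<open>The condition \<open>0 \<le> n\<close> disappears because it follows from \<open>0 \<le> m \<le> n * \<alpha>\<close>.\<close>

lemma mem_beatty_set_iff:
  assumes "m \<in> I" "0 \<le> m" "0 < \<alpha>"
  shows "m \<in> beatty_set I \<alpha> \<longleftrightarrow> (\<exists>n\<in>I. m \<le> n * \<alpha> \<and> n * \<alpha> < m + 1)"
proof -
  have "0 \<le> n" if "m \<le> n * \<alpha>" for n
    using order_trans[OF assms(2) that] assms(3) by (simp add: zero_le_mult_iff)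
  moreover have "m \<in> beatty_set I \<alpha> \<longleftrightarrow> (\<exists>n. n \<in> I \<and> 0 \<le> n \<and> ipart_floor I (n * \<alpha>) = m)"
    unfolding beatty_set_def nonneg_part_def by blast
  ultimately show ?thesis
    unfolding ipart_floor_eq_iff using assms(1) by blast
qed

lemma positive_rational_fraction:
  assumes "rational_over I \<rho>" "0 < \<rho>"
  obtains a b where "a \<in> I" "b \<in> I" "0 < a" "0 < b" "b * \<rho> = a"
proof -
  obtain a b where ab: "a \<in> I" "b \<in> I" "b \<noteq> 0" "\<rho> = a / b"
    using assms(1) unfolding rational_over_def Frac_def by blast
  then have eq: "b * \<rho> = a" by simp
  show thesis
  proof (cases "0 < b")
    case True
    then show thesis
      using that[of a b] ab eq mult_pos_pos[OF True assms(2)] by simp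
  next
    case False
    then have "0 < - b" using ab(3) by simp
    then show thesis
      using that[of "- a" "- b"] ab eq int_minus mult_pos_pos[OF _ assms(2), of "- b"] by simp
  qed
qed

text \<open>The multiple \<open>k * a\<close> is attained exactly, as \<open>k * b * \<rho>\<close>; the multiple of \<open>\<rho>\<close> before it jumps
  over the whole interval \<open>[k * a - 1, k * a)\<close> because \<open>\<rho> > 1\<close>.\<close>

lemma beatty_rational_gap:
  assumes "a \<in> I" "b \<in> I" "0 < a" "b * \<rho> = a" "1 < \<rho>" "k \<in> I" "1 \<le> k"
  shows "k * a \<in> beatty_set I \<rho>" and "k * a - 1 \<notin> beatty_set I \<rho>"
proof -
  have ka: "k * a \<in> I" "0 < k * a"
    using assms int_mult by auto
  have kb: "k * b \<in> I" "k * b * \<rho> = k * a"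
    using assms int_mult by (auto simp: mult.assoc)
  have pos: "0 < \<rho>"
    using assms(5) by (rule less_trans[OF zero_less_one])
  show "k * a \<in> beatty_set I \<rho>"
    using mem_beatty_set_iff[of "k * a" \<rho>] ka kb pos by force
  have "0 \<in> I" using int_diff[OF int_one int_one] by simp
  then have ge: "0 \<le> k * a - 1"
    using int_less_imp_add1_le[of 0 "k * a"] ka by simp
  show "k * a - 1 \<notin> beatty_set I \<rho>"
  proof
    assume "k * a - 1 \<in> beatty_set I \<rho>"
    then obtain n where n: "n \<in> I" "k * a - 1 \<le> n * \<rho>" "n * \<rho> < k * a"
      using mem_beatty_set_iff[OF int_diff[OF ka(1) int_one] ge pos] by auto
    then have "n < k * b"
      using kb(2) pos by (metis mult_less_cancel_right_pos)
    then have "(n + 1) * \<rho> \<le> k * b * \<rho>"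
      using int_less_imp_add1_le[OF n(1) kb(1)] pos by (intro mult_right_mono) auto
    then have "n * \<rho> + \<rho> \<le> k * a"
      unfolding kb(2) by (simp add: distrib_right)
    then show False using n(2) assms(5) by simp
  qed
qed

lemma beatty_gap_excess:
  assumes "1 < \<alpha>" "m \<in> I" "1 \<le> m"
    and "m \<in> beatty_set I \<alpha>" "m - 1 \<notin> beatty_set I \<alpha>"
  obtains n where "n \<in> I" "0 \<le> n * \<alpha> - m" "n * \<alpha> - m < \<alpha> - 1"
proof -
  have pos: "0 < \<alpha>"
    using assms(1) by (rule less_trans[OF zero_less_one])
  obtain n where n: "n \<in> I" "m \<le> n * \<alpha>" "n * \<alpha> < m + 1"
    using mem_beatty_set_iff[of m \<alpha>] assms pos by auto
  have "\<not> (m - 1 \<le> (n - 1) * \<alpha> \<and> (n - 1) * \<alpha> < m)"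
    using mem_beatty_set_iff[OF int_diff[OF assms(2) int_one] _ pos] assms(3,5)
      int_diff[OF n(1) int_one] by auto
  moreover have "(n - 1) * \<alpha> = n * \<alpha> - \<alpha>" by (simp add: algebra_simps)
  moreover have "n * \<alpha> - \<alpha> < m" using n(3) assms(1) by simp
  ultimately have "n * \<alpha> - m < \<alpha> - 1" by simp
  then show thesis using that n by simp
qed

text \<open>This is the escape from the short arc. If \<open>d\<close> is the excess at \<open>a\<close> and \<open>j * d\<close> its first
  multiple beyond \<open>\<alpha> - 1\<close>, then \<open>j * d\<close> and the excess at \<open>j * a\<close> are congruent modulo \<open>I * \<alpha>\<close>, but
  they differ by an amount strictly between \<open>0\<close> and \<open>2 * (\<alpha> - 1) < \<alpha>\<close>.\<close>

lemma no_periodic_gap_if_irrational: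
  assumes "irrational_over I \<alpha>" "1 < \<alpha>" "\<alpha> < 2" "a \<in> I" "0 < a"
    and gap: "\<And>k. k \<in> I \<Longrightarrow> 1 \<le> k \<Longrightarrow> k * a \<in> beatty_set I \<alpha> \<and> k * a - 1 \<notin> beatty_set I \<alpha>"
  shows False
proof -
  have pos: "0 < \<alpha>"
    using assms(2) by (rule less_trans[OF zero_less_one])
  have zero: "0 \<in> I" using int_diff[OF int_one int_one] by simp
  have excess: "\<exists>n\<in>I. 0 \<le> n * \<alpha> - k * a \<and> n * \<alpha> - k * a < \<alpha> - 1" if "k \<in> I" "1 \<le> k" for k
  proof -
    have "k * a \<in> I" "0 < k * a"
      using that assms(4,5) int_mult by auto
    then have "1 \<le> k * a"
      using int_less_imp_add1_le[OF zero] by simp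
    then show ?thesis
      using beatty_gap_excess[OF assms(2) \<open>k * a \<in> I\<close>] gap[OF that] by blast
  qed
  obtain n where n: "n \<in> I" "0 \<le> n * \<alpha> - a" "n * \<alpha> - a < \<alpha> - 1"
    using excess[of 1] int_one by auto
  define d where "d = n * \<alpha> - a"
  have "n * \<alpha> \<noteq> a"
  proof
    assume eq: "n * \<alpha> = a"
    then have "n \<noteq> 0" using assms(5) by auto
    then have "\<alpha> = a / n" using eq by (simp add: field_simps)
    then show False
      using assms(1,4) n(1) \<open>n \<noteq> 0\<close> unfolding irrational_over_def rational_over_def Frac_def by blast
  qed
  then have d: "0 < d" "d < \<alpha> - 1"
    using n unfolding d_def by auto
  obtain q where q: "q \<in> I" "q \<le> (\<alpha> - 1) / d" "(\<alpha> - 1) / d < q + 1"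
    using I unfolding integer_part_def by blast
  define j where "j = q + 1"
  have j: "j \<in> I" "\<alpha> - 1 < j * d" "j * d < 2 * (\<alpha> - 1)"
    using q d int_add int_one unfolding j_def by (auto simp: field_simps)
  have "0 < j * d" using j(2) assms(2) by (metis diff_gt_0_iff_gt less_trans)
  then have "0 < j" using d(1) by (simp add: zero_less_mult_iff)
  then have "1 \<le> j"
    using int_less_imp_add1_le[OF zero j(1)] by simp
  then obtain n' where n': "n' \<in> I" "0 \<le> n' * \<alpha> - j * a" "n' * \<alpha> - j * a < \<alpha> - 1"
    using excess[OF j(1)] by blast
  have diff: "(j * n - n') * \<alpha> = j * d - (n' * \<alpha> - j * a)"
    unfolding d_def by (simp add: algebra_simps)
  have "0 < (j * n - n') * \<alpha>"
    using diff n'(3) j(2) by simp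
  then have "0 < j * n - n'"
    using pos by (metis zero_less_mult_pos2)
  moreover have "(j * n - n') * \<alpha> < 1 * \<alpha>"
    using diff n'(2) j(3) assms(3) by simp
  then have "j * n - n' < 1"
    using pos mult_less_cancel_right_pos by blast
  ultimately show False
    using int_less_imp_add1_le[OF zero int_diff[OF int_mult[OF j(1) n(1)] n'(1)]] by simp
qed

end

theorem mainTheorem7:
  fixes I :: "'a::linordered_field set" and \<rho> \<alpha> :: 'a
  assumes "integer_part I"
    and "rational_over I \<rho>"
    and "irrational_over I \<alpha>"
    and "1 < \<rho>" and "\<rho> < \<alpha>" and "\<alpha> < 2"
  shows "beatty_set I \<rho> \<noteq> beatty_set I \<alpha>"
proof
  assume eq: "beatty_set I \<rho> = beatty_set I \<alpha>"
  have "0 < \<rho>"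
    using assms(4) by (rule less_trans[OF zero_less_one])
  then obtain a b where ab: "a \<in> I" "b \<in> I" "0 < a" "b * \<rho> = a"
    using positive_rational_fraction[OF assms(1,2)] by blast
  have "1 < \<alpha>" using assms(4,5) by simp
  then show False
    using no_periodic_gap_if_irrational[OF assms(1,3) _ assms(6) ab(1,3)]
      beatty_rational_gap[OF assms(1) ab assms(4)] unfolding eq by blast
qed

end
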